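(* Let $\mathcal{P}$ be the set of all non-empty primitive interval orders (up to isomorphism), and define the formal power series \[ \mathbf{P}(t,v,w,x,y)=\sum_{P\in\mathcal{P}} t^{\mathrm{mag}(P)}x^{\mathrm{iso}(P)} y^{\min(P)} v^{\max(P)} w^{\mathrm{int}(P)}. \] For integers $n\ge 0$ let $V_n(a,b)=(a+1)(b+1)^n-1$. Then \[ \mathbf{P}(t,v,w,x,y) =\sum_{n\ge 0}t^{n+1}\frac{V_n(x,y)}{1+tV_n(v,w)}\prod_{i=0}^{n-1}\frac{V_i(v,w)}{1+tV_i(v,w)}. \]
   Context: All posets are finite and considered up to isomorphism. An interval order is a poset with no induced subposet isomorphic to the disjoint union of two 2-element chains. For an element $x$ of a poset $P$, its strict down-set is $D(x)=\{y\in P: y<x\}$ and its strict up-set is $U(x)=\{y\in P: y>x\}$; in an interval order the strict down-sets are totally ordered by inclusion. The magnitude $\mathrm{mag}(P)$ of an interval order $P$ is the number of distinct strict down-sets $D(x)$, $x\in P$. Two elements $x,y$ are indistinguishable if $D(x)=D(y)$ and $U(x)=U(y)$; $P$ is primitive if no two distinct elements are indistinguishable. An element is isolated if it is comparable to no other element, and internal if it is neither minimal nor maximal. The statistics are: $\mathrm{iso}(P)$ = number of isolated elements; $\min(P)$ = number of non-isolated minimal elements; $\max(P)$ = number of non-isolated maximal elements; $\mathrm{int}(P)$ = number of internal elements. The identity is an identity of formal power series (the right-hand side converges in the formal topology). *)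

theory Defs
  imports "HOL-Analysis.Analysis" "HOL-Computational_Algebra.Formal_Power_Series"
begin

text \<open>
  A finite poset is given by its reflexive order relation \<open>r\<close>, with \<open>(x, y) \<in> r\<close> meaning
  \<open>x \<le> y\<close>; the ground set is \<open>Field r\<close>. The strict down-set and the strict up-set of \<open>x\<close>
  are \<open>underS r x\<close> and \<open>aboveS r x\<close>.
\<close>

definition finite_poset :: "'a rel \<Rightarrow> bool" where
  "finite_poset r \<longleftrightarrow> finite (Field r) \<and> Partial_order r"

definition poset_isomorphic :: "'a rel \<Rightarrow> 'b rel \<Rightarrow> bool" where
  "poset_isomorphic r s \<longleftrightarrow>
     (\<exists>f. bij_betw f (Field r) (Field s) \<and>
          (\<forall>x\<in>Field r. \<forall>y\<in>Field r. (x, y) \<in> r \<longleftrightarrow> (f x, f y) \<in> s))"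

definition two_plus_two :: "nat rel" where
  "two_plus_two = {(0,0), (1,1), (2,2), (3,3), (0,1), (2,3)}"

definition interval_order :: "'a rel \<Rightarrow> bool" where
  "interval_order r \<longleftrightarrow>
     finite_poset r \<and> \<not> (\<exists>A\<subseteq>Field r. poset_isomorphic (Restr r A) two_plus_two)"

definition indistinguishable :: "'a rel \<Rightarrow> 'a \<Rightarrow> 'a \<Rightarrow> bool" where
  "indistinguishable r x y \<longleftrightarrow> underS r x = underS r y \<and> aboveS r x = aboveS r y"

definition primitive :: "'a rel \<Rightarrow> bool" where
  "primitive r \<longleftrightarrow>
     \<not> (\<exists>x\<in>Field r. \<exists>y\<in>Field r. x \<noteq> y \<and> indistinguishable r x y)"

definition isolated :: "'a rel \<Rightarrow> 'a \<Rightarrow> bool" where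
  "isolated r x \<longleftrightarrow> (\<forall>y\<in>Field r. y \<noteq> x \<longrightarrow> (x, y) \<notin> r \<and> (y, x) \<notin> r)"

definition minimal :: "'a rel \<Rightarrow> 'a \<Rightarrow> bool" where
  "minimal r x \<longleftrightarrow> \<not> (\<exists>y\<in>Field r. y \<noteq> x \<and> (y, x) \<in> r)"

definition maximal :: "'a rel \<Rightarrow> 'a \<Rightarrow> bool" where
  "maximal r x \<longleftrightarrow> \<not> (\<exists>y\<in>Field r. y \<noteq> x \<and> (x, y) \<in> r)"

definition mag :: "'a rel \<Rightarrow> nat" where
  "mag r = card (underS r ` Field r)"

definition num_iso :: "'a rel \<Rightarrow> nat" where
  "num_iso r = card {x \<in> Field r. isolated r x}"

definition num_min :: "'a rel \<Rightarrow> nat" where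
  "num_min r = card {x \<in> Field r. minimal r x \<and> \<not> isolated r x}"

definition num_max :: "'a rel \<Rightarrow> nat" where
  "num_max r = card {x \<in> Field r. maximal r x \<and> \<not> isolated r x}"

definition num_int :: "'a rel \<Rightarrow> nat" where
  "num_int r = card {x \<in> Field r. \<not> minimal r x \<and> \<not> maximal r x}"

text \<open>
  Every finite poset is isomorphic to one whose ground set consists of natural numbers, so the
  isomorphism classes are taken among relations on \<open>nat\<close>.
\<close>

definition iso_rel :: "nat rel rel" where
  "iso_rel = {(r, s). finite_poset r \<and> finite_poset s \<and> poset_isomorphic r s}"

definition primitive_interval_orders :: "nat rel set set" where
  "primitive_interval_orders =
     {r. Field r \<noteq> {} \<and> interval_order r \<and> primitive r} // iso_rel"

text \<open>
  Power series in five variables are iterated univariate power series, with \<open>t\<close> the outermost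
  variable. The library topology on this type is the \<open>t\<close>-adic one, in which convergence means that
  the coefficient of every power of \<open>t\<close>, a series in \<open>v, w, x, y\<close>, is eventually constant. The
  rational coefficients provide the library's division; \<open>a / b\<close> is the quotient of power series
  whenever \<open>b\<close> has \<open>t\<close>-constant term 1 (see \<open>divide_mult_cancel_unit\<close> below).
\<close>

type_synonym series = "rat fps fps fps fps fps"

definition var_t :: series where "var_t = fps_X"
definition var_v :: series where "var_v = fps_const fps_X"
definition var_w :: series where "var_w = fps_const (fps_const fps_X)"
definition var_x :: series where "var_x = fps_const (fps_const (fps_const fps_X))"
definition var_y :: series where "var_y = fps_const (fps_const (fps_const (fps_const fps_X)))"

definition weight :: "'a rel \<Rightarrow> series" where
  "weight r = var_t ^ mag r * var_x ^ num_iso r * var_y ^ num_min r *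
              var_v ^ num_max r * var_w ^ num_int r"

definition class_weight :: "nat rel set \<Rightarrow> series" where
  "class_weight C = the_elem (weight ` C)"

definition P_series :: series where
  "P_series = (\<Sum>\<^sub>\<infinity>C\<in>primitive_interval_orders. class_weight C)"

definition V :: "nat \<Rightarrow> series \<Rightarrow> series \<Rightarrow> series" where
  "V n a b = (a + 1) * (b + 1) ^ n - 1"

lemma divide_mult_cancel_unit:
  fixes a b :: series
  assumes "fps_nth b 0 = 1"
  shows "(a / b) * b = a"
proof -
  have inv1: "inverse (1 :: rat fps fps fps fps) = 1"
    by (simp add: fps_inverse_one')
  have nz: "b \<noteq> 0" using assms by auto
  have "subdegree b = 0" using assms by (simp add: subdegree_eq_0)
  hence "a / b = a * inverse b" using nz by (simp add: fps_divide_def)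
  moreover have "inverse b * b = 1"
    using fps_left_inverse'[of 1 b "inverse (fps_nth b 0)"] assms inv1
    by (simp add: fps_inverse_def[of b])
  ultimately show ?thesis by (simp add: mult.assoc)
qed

lemma equiv_iso_rel: "equiv {r. finite_poset r} iso_rel"
proof (rule equivI)
  show "iso_rel \<subseteq> {r. finite_poset r} \<times> {r. finite_poset r}"
    by (auto simp: iso_rel_def)
  show "refl_on {r. finite_poset r} iso_rel"
    by (auto simp: refl_on_def iso_rel_def poset_isomorphic_def intro: exI[of _ id])
  show "sym iso_rel"
  proof (rule symI)
    fix r s assume a: "(r, s) \<in> iso_rel"
    then obtain f where f: "bij_betw f (Field r) (Field s)"
      "\<forall>x\<in>Field r. \<forall>y\<in>Field r. (x, y) \<in> r \<longleftrightarrow> (f x, f y) \<in> s"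
      by (auto simp: iso_rel_def poset_isomorphic_def)
    let ?g = "inv_into (Field r) f"
    have "bij_betw ?g (Field s) (Field r)" by (rule bij_betw_inv_into[OF f(1)])
    moreover have "(x, y) \<in> s \<longleftrightarrow> (?g x, ?g y) \<in> r" if "x \<in> Field s" "y \<in> Field s" for x y
      using f(2) that bij_betw_inv_into_right[OF f(1)]
        bij_betwE[OF \<open>bij_betw ?g (Field s) (Field r)\<close>] by simp
    ultimately show "(s, r) \<in> iso_rel"
      using a unfolding iso_rel_def poset_isomorphic_def by blast
  qed
  show "trans iso_rel"
  proof (rule transI)
    fix r s u assume a: "(r, s) \<in> iso_rel" "(s, u) \<in> iso_rel"
    then obtain f g where fg: "bij_betw f (Field r) (Field s)"
      "\<forall>x\<in>Field r. \<forall>y\<in>Field r. (x, y) \<in> r \<longleftrightarrow> (f x, f y) \<in> s"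
      "bij_betw g (Field s) (Field u)"
      "\<forall>x\<in>Field s. \<forall>y\<in>Field s. (x, y) \<in> s \<longleftrightarrow> (g x, g y) \<in> u"
      by (auto simp: iso_rel_def poset_isomorphic_def)
    have "bij_betw (g \<circ> f) (Field r) (Field u)" using fg(1,3) by (rule bij_betw_trans)
    moreover have "\<forall>x\<in>Field r. \<forall>y\<in>Field r. (x, y) \<in> r \<longleftrightarrow> ((g \<circ> f) x, (g \<circ> f) y) \<in> u"
      using fg(2,4) bij_betwE[OF fg(1)] by simp
    ultimately show "(r, u) \<in> iso_rel"
      using a unfolding iso_rel_def poset_isomorphic_def by blast
  qed
qed

lemma weight_cong_iso:
  assumes "poset_isomorphic r s"
  shows "weight r = weight s"
proof -
  obtain f where f: "bij_betw f (Field r) (Field s)"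
    and fr: "\<And>x y. x \<in> Field r \<Longrightarrow> y \<in> Field r \<Longrightarrow> (x, y) \<in> r \<longleftrightarrow> (f x, f y) \<in> s"
    using assms by (auto simp: poset_isomorphic_def)
  have im: "f ` Field r = Field s" and inj: "inj_on f (Field r)"
    using f by (auto simp: bij_betw_def)
  have eq: "f x = f y \<longleftrightarrow> x = y" if "x \<in> Field r" "y \<in> Field r" for x y
    using inj that by (auto dest: inj_onD)
  have card_eq: "card {x \<in> Field r. Q x} = card {x \<in> Field s. Q' x}"
    if "\<And>x. x \<in> Field r \<Longrightarrow> Q x \<longleftrightarrow> Q' (f x)" for Q Q'
  proof -
    have "{x \<in> Field s. Q' x} = f ` {x \<in> Field r. Q x}"
      using that by (auto simp flip: im)
    moreover have "inj_on f {x \<in> Field r. Q x}" using inj by (rule inj_on_subset) auto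
    ultimately show ?thesis by (simp add: card_image)
  qed
  have isol: "isolated r x \<longleftrightarrow> isolated s (f x)" if "x \<in> Field r" for x
    using that by (auto simp: isolated_def fr eq simp flip: im)
  have mini: "minimal r x \<longleftrightarrow> minimal s (f x)" if "x \<in> Field r" for x
    using that by (auto simp: minimal_def fr eq simp flip: im)
  have maxi: "maximal r x \<longleftrightarrow> maximal s (f x)" if "x \<in> Field r" for x
    using that by (auto simp: maximal_def fr eq simp flip: im)
  have under: "underS s (f x) = f ` underS r x" if x: "x \<in> Field r" for x
  proof (intro equalityI subsetI)
    fix z assume z: "z \<in> underS s (f x)"
    hence "z \<in> Field s" by (auto simp: underS_def Field_def)
    then obtain y where "y \<in> Field r" "z = f y" using im by auto
    with z x show "z \<in> f ` underS r x" by (auto simp: underS_def fr eq)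
  next
    fix z assume "z \<in> f ` underS r x"
    then obtain y where y: "y \<in> underS r x" "z = f y" by auto
    hence "y \<in> Field r" by (auto simp: underS_def Field_def)
    with y x show "z \<in> underS s (f x)" by (auto simp: underS_def fr eq)
  qed
  have "underS s ` Field s = image f ` (underS r ` Field r)"
    by (simp add: image_image under flip: im)
  moreover have "inj_on (image f) (underS r ` Field r)"
  proof (rule inj_on_subset[OF inj_on_image_Pow[OF inj]])
    show "underS r ` Field r \<subseteq> Pow (Field r)" by (auto simp: underS_def Field_def)
  qed
  ultimately have "mag r = mag s" by (simp add: mag_def card_image)
  moreover have "num_iso r = num_iso s"
    unfolding num_iso_def by (intro card_eq isol)
  moreover have "num_min r = num_min s"
    unfolding num_min_def by (intro card_eq) (simp add: isol mini)
  moreover have "num_max r = num_max s"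
    unfolding num_max_def by (intro card_eq) (simp add: isol maxi)
  moreover have "num_int r = num_int s"
    unfolding num_int_def by (intro card_eq) (simp add: mini maxi)
  ultimately show ?thesis by (simp add: weight_def)
qed

lemma class_weight_eq:
  assumes "finite_poset r"
  shows "class_weight (iso_rel `` {r}) = weight r"
proof -
  have "r \<in> iso_rel `` {r}"
    using equiv_class_self[OF equiv_iso_rel] assms by simp
  moreover have "weight s = weight r" if "s \<in> iso_rel `` {r}" for s
    using that weight_cong_iso[of r s] by (simp add: iso_rel_def)
  ultimately have "weight ` (iso_rel `` {r}) = {weight r}"
    by blast
  thus ?thesis by (simp add: class_weight_def)
qed

end

theory Submission
  imports Defs
begin

text \<open>
  Numbering the distinct strict down-sets of an interval order \<open>0, \<dots>, m - 1\<close> by inclusion, send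
  \<open>x\<close> to \<open>(i, j)\<close>, where \<open>i\<close> is the number of \<open>D(x)\<close> and \<open>j\<close> counts the down-sets not containing
  \<open>x\<close>; then \<open>x < y\<close> iff the \<open>j\<close> of \<open>x\<close> is at most the \<open>i\<close> of \<open>y\<close>. This identifies the primitive
  interval orders of magnitude \<open>m\<close> with the sets of cells \<open>(i, j)\<close>, \<open>0 \<le> i < j \<le> m\<close>, that meet
  every row and every column; minimal elements lie in row \<open>0\<close>, maximal ones in column \<open>m\<close>.

  Let \<open>F\<^sub>a(k)\<close> be the total weight of the fillings of rows \<open>0, \<dots>, a\<close> that meet each of these rows
  and the columns \<open>1, \<dots>, a\<close>, where column \<open>m\<close> and \<open>k\<close> further columns to the right of \<open>a\<close> may
  be used freely. Removing row \<open>a\<close>, which contributes \<open>V\<^sub>k(v, w)\<close>, leaves a filling of the rows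
  before it that has column \<open>a\<close> as an additional free column and does use it, so
  \<open>F\<^sub>a(k) = V\<^sub>k(v, w) (F\<^sub>a\<^sub>-\<^sub>1(k + 1) - F\<^sub>a\<^sub>-\<^sub>1(k))\<close> with \<open>F\<^sub>0(k) = V\<^sub>k(x, y)\<close>, and the
  coefficient of \<open>t\<^sup>m\<close> is \<open>F\<^sub>m\<^sub>-\<^sub>1(0)\<close>. Summation by parts turns the generating function of
  such iterated weighted differences into the product formula.
\<close>

section \<open>Ranks in finite chains of sets\<close>

lemma card_psubsets_less_iff:
  assumes "finite \<D>" "chain\<^sub>\<subseteq> \<D>" "D \<in> \<D>" "E \<in> \<D>"
  shows "card {B \<in> \<D>. B \<subset> D} < card {B \<in> \<D>. B \<subset> E} \<longleftrightarrow> D \<subset> E"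
proof (cases "D \<subset> E")
  case True
  hence "{B \<in> \<D>. B \<subset> D} \<subset> {B \<in> \<D>. B \<subset> E}"
    using assms(3) by blast
  thus ?thesis
    using True assms(1) by (simp add: psubset_card_mono)
next
  case False
  hence "E \<subseteq> D"
    using assms(2-4) unfolding chain_subset_def by blast
  hence "{B \<in> \<D>. B \<subset> E} \<subseteq> {B \<in> \<D>. B \<subset> D}"
    by blast
  hence "card {B \<in> \<D>. B \<subset> E} \<le> card {B \<in> \<D>. B \<subset> D}"
    using assms(1) by (intro card_mono) auto
  thus ?thesis
    using False by simp
qed

lemma bij_betw_card_psubsets:
  assumes "finite \<D>" "chain\<^sub>\<subseteq> \<D>"
  shows "bij_betw (\<lambda>D. card {B \<in> \<D>. B \<subset> D}) \<D> {..<card \<D>}"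
proof -
  let ?rank = "\<lambda>D. card {B \<in> \<D>. B \<subset> D}"
  have inj: "inj_on ?rank \<D>"
  proof (rule inj_onI)
    fix D E assume D: "D \<in> \<D>" and E: "E \<in> \<D>" and "?rank D = ?rank E"
    hence "\<not> D \<subset> E" "\<not> E \<subset> D"
      using card_psubsets_less_iff[OF assms D E] card_psubsets_less_iff[OF assms E D] by simp_all
    thus "D = E"
      using assms(2) D E unfolding chain_subset_def by blast
  qed
  have "?rank D < card \<D>" if "D \<in> \<D>" for D
    using assms(1) that by (intro psubset_card_mono) auto
  hence "?rank ` \<D> = {..<card \<D>}"
    by (intro card_subset_eq) (auto simp: card_image[OF inj])
  thus ?thesis
    using inj by (simp add: bij_betw_def)
qed

section \<open>Series of formal power series\<close>

lemma fps_X_power_dvd_imp_nth_eq_0: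
  fixes f :: "'a::comm_ring_1 fps"
  assumes "fps_X ^ n dvd f" "i < n"
  shows "fps_nth f i = 0"
  using assms by (auto elim!: dvdE simp: fps_X_power_mult_nth)

lemma fps_sums_iff_nth_eq:
  fixes a :: "nat \<Rightarrow> 'a::comm_ring_1 fps"
  assumes "\<And>m. fps_X ^ m dvd a m"
  shows "a sums S \<longleftrightarrow> (\<forall>n. fps_nth S n = (\<Sum>m\<le>n. fps_nth (a m) n))"
proof -
  have stable: "\<forall>\<^sub>F N in sequentially. fps_nth (\<Sum>m<N. a m) n = (\<Sum>m\<le>n. fps_nth (a m) n)" for n
    using eventually_gt_at_top[of n]
  proof eventually_elim
    case (elim N)
    thus ?case
      unfolding fps_sum_nth
      by (intro sum.mono_neutral_right) (auto intro: fps_X_power_dvd_imp_nth_eq_0[OF assms])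
  qed
  have "(\<forall>\<^sub>F N in sequentially. fps_nth (\<Sum>m<N. a m) n = fps_nth S n) \<longleftrightarrow>
      (\<forall>\<^sub>F N in sequentially. fps_nth S n = (\<Sum>m\<le>n. fps_nth (a m) n))" for n
    by (rule eventually_cong[OF stable]) auto
  thus ?thesis
    by (simp add: sums_def tendsto_fps_iff)
qed

lemma fps_summableI:
  fixes a :: "nat \<Rightarrow> 'a::comm_ring_1 fps"
  assumes "\<And>m. fps_X ^ m dvd a m"
  shows "summable a"
  using fps_sums_iff_nth_eq[OF assms, of "Abs_fps (\<lambda>n. \<Sum>m\<le>n. fps_nth (a m) n)"]
  by (auto simp: summable_def)

lemma has_sum_Sigma_fps:
  fixes h :: "nat \<times> 'b \<Rightarrow> 'a::comm_ring_1 fps"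
  assumes fin: "\<And>m. finite (B m)"
    and dvd: "\<And>m x. x \<in> B m \<Longrightarrow> fps_X ^ m dvd h (m, x)"
    and sums: "(\<lambda>m. \<Sum>x\<in>B m. h (m, x)) sums S"
  shows "(h has_sum S) (Sigma UNIV B)"
proof (rule has_sum_fpsI)
  fix n
  let ?support = "{p \<in> Sigma UNIV B. fps_nth (h p) n \<noteq> 0}"
  have support: "?support \<subseteq> Sigma {..n} B"
    using fps_X_power_dvd_imp_nth_eq_0[OF dvd] by (fastforce simp: not_le[symmetric])
  show "finite ?support"
    by (rule finite_subset[OF support]) (simp add: fin)
  have "fps_nth S n = (\<Sum>m\<le>n. fps_nth (\<Sum>x\<in>B m. h (m, x)) n)"
    using sums fps_sums_iff_nth_eq[of "\<lambda>m. \<Sum>x\<in>B m. h (m, x)" S] by (simp add: dvd dvd_sum)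
  also have "\<dots> = (\<Sum>p\<in>Sigma {..n} B. fps_nth (h p) n)"
    by (simp add: fps_sum_nth sum.Sigma fin split_beta)
  also have "\<dots> = (\<Sum>p\<in>?support. fps_nth (h p) n)"
    by (rule sum.mono_neutral_right) (use support fin in auto)
  finally show "fps_nth S n = (\<Sum>p\<in>?support. fps_nth (h p) n)" .
qed

lemma fps_sums_cong_mod:
  fixes a b :: "nat \<Rightarrow> 'a::comm_ring_1 fps"
  assumes "\<And>N. fps_X ^ N dvd (\<Sum>n<N. a n) - (\<Sum>n<N. b n)" and "b sums S"
  shows "a sums S"
  unfolding sums_def
proof (rule tendsto_fpsI)
  fix n
  have "\<forall>\<^sub>F N in sequentially. fps_nth (\<Sum>m<N. b m) n = fps_nth S n"
    using assms(2) by (simp add: sums_def tendsto_fps_iff)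
  thus "\<forall>\<^sub>F N in sequentially. fps_nth (\<Sum>m<N. a m) n = fps_nth S n"
    using eventually_gt_at_top[of n]
  proof eventually_elim
    case (elim N)
    thus ?case
      using fps_X_power_dvd_imp_nth_eq_0[OF assms(1)] by fastforce
  qed
qed

section \<open>Iterated weighted differences\<close>

definition weighted_diff :: "(nat \<Rightarrow> 'a::comm_ring_1) \<Rightarrow> (nat \<Rightarrow> 'a) \<Rightarrow> nat \<Rightarrow> 'a" where
  "weighted_diff \<alpha> f n = \<alpha> n * (f (Suc n) - f n)"

lemma sum_weighted_diff_by_parts:
  fixes x :: "'a::comm_ring_1"
  assumes inverse: "\<And>n. e n * (1 + x * \<alpha> n) = 1"
  shows "(\<Sum>n<N. x ^ n * (f n * e n) * (\<Prod>i<n. \<alpha> i * e i)) + x ^ N * f N * (\<Prod>i<N. \<alpha> i * e i) =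
    f 0 + x * (\<Sum>n<N. x ^ n * (weighted_diff \<alpha> f n * e n) * (\<Prod>i<n. \<alpha> i * e i))"
    (is "?S f N + ?R N = _ + x * ?S ?\<Delta>f N")
proof (induction N)
  case (Suc N)
  have "?R N = ?R N * (e N * (1 + x * \<alpha> N))"
    by (simp add: inverse)
  hence "?S f (Suc N) + ?R (Suc N) =
      ?S f N + ?R N + x * (x ^ N * (?\<Delta>f N * e N) * (\<Prod>i<N. \<alpha> i * e i))"
    by (simp add: weighted_diff_def algebra_simps)
  also have "\<dots> = f 0 + x * ?S ?\<Delta>f (Suc N)"
    by (simp add: Suc distrib_left add.assoc)
  finally show ?case .
qed simp

lemma power_dvd_sum_diff_funpow_weighted_diff:
  fixes x :: "'a::comm_ring_1"
  assumes inverse: "\<And>n. e n * (1 + x * \<alpha> n) = 1"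
  shows "x ^ N dvd (\<Sum>n<N. x ^ n * (f n * e n) * (\<Prod>i<n. \<alpha> i * e i)) -
    (\<Sum>j<N. x ^ j * (weighted_diff \<alpha> ^^ j) f 0)"
proof -
  define \<Phi> where "\<Phi> g = (\<Sum>n<N. x ^ n * (g n * e n) * (\<Prod>i<n. \<alpha> i * e i))" for g
  define R where "R g = x ^ N * g N * (\<Prod>i<N. \<alpha> i * e i)" for g
  have by_parts: "\<Phi> g = g 0 + x * \<Phi> (weighted_diff \<alpha> g) - R g" for g
    using sum_weighted_diff_by_parts[OF inverse, where f = g and N = N]
    by (simp add: \<Phi>_def R_def eq_diff_eq)
  have "x ^ N dvd \<Phi> f - (\<Sum>j<J. x ^ j * (weighted_diff \<alpha> ^^ j) f 0)
      - x ^ J * \<Phi> ((weighted_diff \<alpha> ^^ J) f)" for J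
  proof (induction J)
    case (Suc J)
    let ?g = "(weighted_diff \<alpha> ^^ J) f"
    have "\<Phi> f - (\<Sum>j<Suc J. x ^ j * (weighted_diff \<alpha> ^^ j) f 0)
        - x ^ Suc J * \<Phi> ((weighted_diff \<alpha> ^^ Suc J) f) =
      (\<Phi> f - (\<Sum>j<J. x ^ j * (weighted_diff \<alpha> ^^ j) f 0) - x ^ J * \<Phi> ?g) - x ^ J * R ?g"
      using arg_cong[OF by_parts[of ?g], of "(*) (x ^ J)"] by (simp add: algebra_simps)
    also have "x ^ N dvd \<dots>"
      by (rule dvd_diff[OF Suc]) (simp add: R_def)
    finally show ?case .
  qed simp
  from dvd_add[OF this[of N] dvd_triv_left[of "x ^ N" "\<Phi> ((weighted_diff \<alpha> ^^ N) f)"]]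
  show ?thesis
    by (simp add: \<Phi>_def)
qed

lemma series_divide_eq:
  fixes a b :: series
  assumes "fps_nth b 0 = 1"
  shows "a / b = a * inverse b"
  using assms by (intro fps_divide_unit') (simp add: subdegree_eq_0)

lemma series_inverse_mult:
  fixes b :: series
  assumes "fps_nth b 0 = 1"
  shows "inverse b * b = 1"
  using divide_mult_cancel_unit[OF assms, of 1] by (simp add: series_divide_eq[OF assms])

lemma sums_quotients_if_sums_weighted_diff:
  fixes f \<alpha> :: "nat \<Rightarrow> series"
  assumes "(\<lambda>n. var_t ^ (n + 1) * (weighted_diff \<alpha> ^^ n) f 0) sums S"
  shows "(\<lambda>n. var_t ^ (n + 1) * (f n / (1 + var_t * \<alpha> n)) *
    (\<Prod>i<n. \<alpha> i / (1 + var_t * \<alpha> i))) sums S"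
proof (rule fps_sums_cong_mod[OF _ assms])
  fix N
  define e where "e n = inverse (1 + var_t * \<alpha> n)" for n
  have unit: "fps_nth (1 + var_t * \<alpha> n) 0 = 1" for n
    by (simp add: var_t_def)
  have inverse: "e n * (1 + var_t * \<alpha> n) = 1" for n
    by (simp add: e_def series_inverse_mult[OF unit])
  have "var_t ^ N dvd var_t * ((\<Sum>n<N. var_t ^ n * (f n * e n) * (\<Prod>i<n. \<alpha> i * e i)) -
      (\<Sum>n<N. var_t ^ n * (weighted_diff \<alpha> ^^ n) f 0))"
    by (intro dvd_mult power_dvd_sum_diff_funpow_weighted_diff inverse)
  thus "fps_X ^ N dvd
      (\<Sum>n<N. var_t ^ (n + 1) * (f n / (1 + var_t * \<alpha> n)) * (\<Prod>i<n. \<alpha> i / (1 + var_t * \<alpha> i))) -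
      (\<Sum>n<N. var_t ^ (n + 1) * (weighted_diff \<alpha> ^^ n) f 0)"
    by (simp add: series_divide_eq[OF unit] e_def right_diff_distrib sum_distrib_left mult.assoc
        flip: var_t_def)
qed

section \<open>Canonical interval representations\<close>

lemma minimal_iff_underS_empty: "minimal r x \<longleftrightarrow> underS r x = {}"
  by (auto simp: minimal_def underS_def intro: FieldI1)

lemma maximal_iff_aboveS_empty: "maximal r x \<longleftrightarrow> aboveS r x = {}"
  by (auto simp: maximal_def aboveS_def intro: FieldI2)

lemma isolated_iff_minimal_maximal: "isolated r x \<longleftrightarrow> minimal r x \<and> maximal r x"
  by (auto simp: isolated_def minimal_def maximal_def)

definition left_end :: "'a rel \<Rightarrow> 'a \<Rightarrow> nat" where
  "left_end r x = card {D \<in> underS r ` Field r. D \<subset> underS r x}"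

definition right_end :: "'a rel \<Rightarrow> 'a \<Rightarrow> nat" where
  "right_end r x = card {D \<in> underS r ` Field r. x \<notin> D}"

lemma indistinguishable_imp_right_end_eq:
  assumes "indistinguishable r x y"
  shows "right_end r x = right_end r y"
proof -
  have "x \<in> underS r z \<longleftrightarrow> y \<in> underS r z" for z
    using assms by (auto simp: indistinguishable_def underS_def aboveS_def)
  thus ?thesis
    by (auto simp: right_end_def intro: arg_cong[where f = card])
qed

locale canonical_representation =
  fixes r :: "'a rel" and m :: nat and lo hi :: "'a \<Rightarrow> nat"
  assumes finite_Field: "finite (Field r)"
    and lo_less_hi: "x \<in> Field r \<Longrightarrow> lo x < hi x"
    and mem_iff: "x \<in> Field r \<Longrightarrow> y \<in> Field r \<Longrightarrow> (x, y) \<in> r \<longleftrightarrow> x = y \<or> hi x \<le> lo y"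
    and image_lo: "lo ` Field r = {..<m}"
    and image_hi: "hi ` Field r = {1..m}"
begin

lemma lo_less: "x \<in> Field r \<Longrightarrow> lo x < m"
  using image_lo by blast

lemma hi_le: "x \<in> Field r \<Longrightarrow> hi x \<le> m"
  using image_hi by (metis atLeastAtMost_iff imageI)

lemma ex_lo_eq: "k < m \<Longrightarrow> \<exists>x\<in>Field r. lo x = k"
  using image_lo by (metis imageE lessThan_iff)

lemma ex_hi_eq:
  assumes "0 < k" "k \<le> m"
  shows "\<exists>x\<in>Field r. hi x = k"
proof -
  have "k \<in> hi ` Field r"
    using assms by (simp add: image_hi)
  thus ?thesis
    by blast
qed

definition hi_sublevel :: "nat \<Rightarrow> 'a set" where
  "hi_sublevel k = {y \<in> Field r. hi y \<le> k}"

lemma underS_eq: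
  assumes "x \<in> Field r"
  shows "underS r x = hi_sublevel (lo x)"
  using lo_less_hi[OF assms] mem_iff[OF _ assms]
  by (auto simp: underS_def hi_sublevel_def intro: FieldI1)

lemma aboveS_eq:
  assumes "x \<in> Field r"
  shows "aboveS r x = {y \<in> Field r. hi x \<le> lo y}"
  using lo_less_hi[OF assms] mem_iff[OF assms] by (auto simp: aboveS_def intro: FieldI2)

lemma hi_sublevel_psubset_iff:
  assumes "k < m" "l < m"
  shows "hi_sublevel k \<subset> hi_sublevel l \<longleftrightarrow> k < l"
proof (cases "k < l")
  case True
  then obtain y where "y \<in> Field r" "hi y = l"
    using ex_hi_eq[of l] assms by auto
  hence "y \<in> hi_sublevel l - hi_sublevel k"
    using True by (simp add: hi_sublevel_def)
  moreover have "hi_sublevel k \<subseteq> hi_sublevel l"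
    using True by (auto simp: hi_sublevel_def)
  ultimately show ?thesis
    using True by blast
next
  case False
  hence "hi_sublevel l \<subseteq> hi_sublevel k"
    by (auto simp: hi_sublevel_def)
  thus ?thesis
    using False by blast
qed

lemma card_underS_image:
  "card {D \<in> underS r ` Field r. Q D} = card {k. k < m \<and> Q (hi_sublevel k)}"
proof -
  have "underS r ` Field r = hi_sublevel ` lo ` Field r"
    by (simp add: image_image underS_eq)
  hence "{D \<in> underS r ` Field r. Q D} = hi_sublevel ` {k. k < m \<and> Q (hi_sublevel k)}"
    by (auto simp: image_lo)
  moreover have "inj_on hi_sublevel {k. k < m \<and> Q (hi_sublevel k)}"
    by (rule linorder_inj_onI') (use hi_sublevel_psubset_iff in blast)
  ultimately show ?thesis
    by (simp add: card_image)
qed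

lemma mag_eq: "mag r = m"
  using card_underS_image[of "\<lambda>_. True"] by (simp add: mag_def)

lemma left_end_eq:
  assumes "x \<in> Field r"
  shows "left_end r x = lo x"
proof -
  have "k < m \<and> hi_sublevel k \<subset> underS r x \<longleftrightarrow> k < lo x" for k
    using lo_less[OF assms] hi_sublevel_psubset_iff[of k "lo x"] by (auto simp: underS_eq[OF assms])
  thus ?thesis
    by (simp add: left_end_def card_underS_image flip: lessThan_def)
qed

lemma right_end_eq:
  assumes "x \<in> Field r"
  shows "right_end r x = hi x"
proof -
  have "{k. k < m \<and> x \<notin> hi_sublevel k} = {..<hi x}"
    using hi_le[OF assms] assms by (auto simp: hi_sublevel_def)
  thus ?thesis
    by (simp add: right_end_def card_underS_image)
qed

lemma minimal_iff:
  assumes "x \<in> Field r"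
  shows "minimal r x \<longleftrightarrow> lo x = 0"
proof
  assume "minimal r x"
  hence "\<not> (\<exists>y\<in>Field r. hi y = lo x)"
    by (auto simp: minimal_iff_underS_empty underS_eq[OF assms] hi_sublevel_def)
  thus "lo x = 0"
    using ex_hi_eq[of "lo x"] lo_less[OF assms] by fastforce
next
  assume "lo x = 0"
  thus "minimal r x"
    by (auto simp: minimal_iff_underS_empty underS_eq[OF assms] hi_sublevel_def dest: lo_less_hi)
qed

lemma maximal_iff:
  assumes "x \<in> Field r"
  shows "maximal r x \<longleftrightarrow> hi x = m"
proof
  assume "maximal r x"
  hence "\<not> (\<exists>y\<in>Field r. lo y = hi x)"
    by (auto simp: maximal_iff_aboveS_empty aboveS_eq[OF assms])
  thus "hi x = m"
    using ex_lo_eq[of "hi x"] hi_le[OF assms] by fastforce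
next
  assume "hi x = m"
  thus "maximal r x"
    by (auto simp: maximal_iff_aboveS_empty aboveS_eq[OF assms] dest: lo_less)
qed

lemma indistinguishable_iff:
  assumes "x \<in> Field r" "y \<in> Field r"
  shows "indistinguishable r x y \<longleftrightarrow> lo x = lo y \<and> hi x = hi y"
proof
  assume indist: "indistinguishable r x y"
  hence "left_end r x = left_end r y"
    by (simp add: indistinguishable_def left_end_def)
  thus "lo x = lo y \<and> hi x = hi y"
    using assms indistinguishable_imp_right_end_eq[OF indist]
    by (simp add: left_end_eq right_end_eq)
qed (simp add: assms indistinguishable_def underS_eq aboveS_eq)

lemma primitive_iff: "primitive r \<longleftrightarrow> inj_on (\<lambda>x. (lo x, hi x)) (Field r)"
  using indistinguishable_iff by (auto simp: primitive_def inj_on_def)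

lemma finite_poset: "finite_poset r"
proof -
  have "r \<subseteq> Field r \<times> Field r"
    by (auto intro: FieldI1 FieldI2)
  moreover have "refl_on (Field r) r"
    by (simp add: refl_on_def mem_iff)
  moreover have "trans r"
  proof (rule transI)
    fix x y z assume "(x, y) \<in> r" "(y, z) \<in> r"
    moreover from this have "x \<in> Field r" "y \<in> Field r" "z \<in> Field r"
      by (auto intro: FieldI1 FieldI2)
    ultimately show "(x, z) \<in> r"
      using lo_less_hi[of y] by (auto simp: mem_iff)
  qed
  moreover have "antisym r"
  proof (rule antisymI)
    fix x y assume "(x, y) \<in> r" "(y, x) \<in> r"
    moreover from this have "x \<in> Field r" "y \<in> Field r"
      by (auto intro: FieldI1 FieldI2)
    ultimately show "x = y"
      using lo_less_hi[of x] lo_less_hi[of y] by (auto simp: mem_iff)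
  qed
  ultimately show ?thesis
    using finite_Field by (simp add: finite_poset_def partial_order_on_def preorder_on_def)
qed

lemma chain_subset_underS: "chain\<^sub>\<subseteq> (underS r ` Field r)"
proof -
  have "hi_sublevel k \<subseteq> hi_sublevel l \<or> hi_sublevel l \<subseteq> hi_sublevel k" for k l
    using nat_le_linear[of k l] by (auto simp: hi_sublevel_def)
  thus ?thesis
    by (simp add: chain_subset_def underS_eq)
qed

lemma pullback:
  assumes f: "bij_betw f (Field s) (Field r)"
    and iso: "\<And>x y. x \<in> Field s \<Longrightarrow> y \<in> Field s \<Longrightarrow> (x, y) \<in> s \<longleftrightarrow> (f x, f y) \<in> r"
  shows "canonical_representation s m (lo \<circ> f) (hi \<circ> f)"
proof
  have image: "f ` Field s = Field r" and inj: "inj_on f (Field s)"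
    using f by (auto simp: bij_betw_def)
  show "finite (Field s)"
    using finite_Field bij_betw_finite[OF f] by simp
  show "(lo \<circ> f) ` Field s = {..<m}" "(hi \<circ> f) ` Field s = {1..m}"
    using image image_lo image_hi by (simp_all only: image_comp[symmetric])
  fix x assume x: "x \<in> Field s"
  show "(lo \<circ> f) x < (hi \<circ> f) x"
    using x image lo_less_hi by auto
  fix y assume y: "y \<in> Field s"
  have "f x \<in> Field r" "f y \<in> Field r"
    using x y image by auto
  thus "(x, y) \<in> s \<longleftrightarrow> x = y \<or> (hi \<circ> f) x \<le> (lo \<circ> f) y"
    using iso[OF x y] inj_on_eq_iff[OF inj x y] by (simp add: mem_iff)
qed

end

section \<open>Interval orders\<close>

lemma Field_two_plus_two: "Field two_plus_two = {0, 1, 2, 3}"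
  by (auto simp: two_plus_two_def Field_def)

lemma not_chain_underS_if_two_plus_two:
  assumes "finite_poset r" "A \<subseteq> Field r" "poset_isomorphic (Restr r A) two_plus_two"
  shows "\<not> chain\<^sub>\<subseteq> (underS r ` Field r)"
proof -
  have "Field (Restr r A) = A"
    using assms(1,2) Refl_Field_Restr2
    by (auto simp: finite_poset_def partial_order_on_def preorder_on_def)
  then obtain f where f: "bij_betw f A {0, 1, 2, 3}"
    and iso: "\<And>x y. x \<in> A \<Longrightarrow> y \<in> A \<Longrightarrow> (x, y) \<in> r \<longleftrightarrow> (f x, f y) \<in> two_plus_two"
    using assms(3) unfolding poset_isomorphic_def Field_two_plus_two by auto
  have "\<exists>x\<in>A. f x = k" if "k \<in> {0, 1, 2, 3}" for k
    using f that by (metis bij_betw_def imageE)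
  then obtain p x q y where "p \<in> A" "f p = 0" "x \<in> A" "f x = 1" "q \<in> A" "f q = 2" "y \<in> A" "f y = 3"
    by (meson insertCI)
  hence "p \<in> underS r x - underS r y" "q \<in> underS r y - underS r x"
    by (auto simp: underS_def iso two_plus_two_def)
  moreover have "x \<in> Field r" "y \<in> Field r"
    using \<open>x \<in> A\<close> \<open>y \<in> A\<close> assms(2) by auto
  ultimately show ?thesis
    unfolding chain_subset_def by blast
qed

lemma incomparable_if_underS_crossing:
  assumes "Partial_order r"
    and p: "p \<in> underS r x - underS r y" and q: "q \<in> underS r y - underS r x"
  shows "({p, x} \<times> {q, y} \<union> {q, y} \<times> {p, x}) \<inter> r = {}"
proof -
  have trans: "trans r" and antisym: "antisym r"
    using assms(1) by (auto simp: partial_order_on_def preorder_on_def)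
  have less: "(p, x) \<in> r" "p \<noteq> x" "(q, y) \<in> r" "q \<noteq> y"
    using p q by (auto simp: underS_def)
  have "p \<noteq> y" "q \<noteq> x"
    using less p q transD[OF trans] antisymD[OF antisym] unfolding underS_def by blast+
  hence "(p, y) \<notin> r" "(q, x) \<notin> r"
    using p q by (auto simp: underS_def)
  moreover from this have "(p, q) \<notin> r" "(q, p) \<notin> r" "(x, y) \<notin> r" "(y, x) \<notin> r"
      "(x, q) \<notin> r" "(y, p) \<notin> r"
    using less transD[OF trans] by metis+
  ultimately show ?thesis
    by blast
qed

lemma two_plus_two_if_not_chain_underS:
  assumes "finite_poset r" "\<not> chain\<^sub>\<subseteq> (underS r ` Field r)"
  shows "\<exists>A\<subseteq>Field r. poset_isomorphic (Restr r A) two_plus_two"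
proof -
  have order: "Partial_order r" "Refl r" "antisym r"
    using assms(1) by (auto simp: finite_poset_def partial_order_on_def preorder_on_def)
  obtain x y p q where xy: "x \<in> Field r" "y \<in> Field r"
    and p: "p \<in> underS r x - underS r y" and q: "q \<in> underS r y - underS r x"
    using assms(2) unfolding chain_subset_def by blast
  have pq: "p \<in> Field r" "q \<in> Field r"
    using p q underS_Field by fastforce+
  have less: "(p, x) \<in> r" "p \<noteq> x" "(q, y) \<in> r" "q \<noteq> y"
    using p q by (auto simp: underS_def)
  hence not_greater: "(x, p) \<notin> r" "(y, q) \<notin> r"
    using antisymD[OF order(3)] by auto
  have refl: "(p, p) \<in> r" "(x, x) \<in> r" "(q, q) \<in> r" "(y, y) \<in> r"
    using order(2) pq xy by (auto simp: refl_on_def)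
  have incomparable: "(p, q) \<notin> r" "(p, y) \<notin> r" "(x, q) \<notin> r" "(x, y) \<notin> r"
      "(q, p) \<notin> r" "(q, x) \<notin> r" "(y, p) \<notin> r" "(y, x) \<notin> r"
    using incomparable_if_underS_crossing[OF order(1) p q] by blast+
  have distinct: "distinct [p, x, q, y]"
    using less incomparable refl by auto
  let ?A = "{p, x, q, y}"
  define f where "f = (\<lambda>_. 3::nat)(p := 0, x := 1, q := 2)"
  have f: "f p = 0" "f x = 1" "f q = 2" "f y = 3"
    using distinct by (auto simp: f_def)
  have "Field (Restr r ?A) = ?A"
    using Refl_Field_Restr2[OF order(2), of ?A] pq xy by blast
  moreover have "bij_betw f ?A {0, 1, 2, 3}"
    unfolding bij_betw_def inj_on_def using f by auto
  moreover have "\<forall>u\<in>?A. \<forall>v\<in>?A. (u, v) \<in> Restr r ?A \<longleftrightarrow> (f u, f v) \<in> two_plus_two"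
    using f refl less not_greater incomparable distinct by (auto simp: two_plus_two_def)
  ultimately have "poset_isomorphic (Restr r ?A) two_plus_two"
    unfolding poset_isomorphic_def Field_two_plus_two by metis
  thus ?thesis
    using pq xy by (intro exI[of _ ?A]) simp
qed

lemma interval_order_iff_chain_underS:
  "interval_order r \<longleftrightarrow> finite_poset r \<and> chain\<^sub>\<subseteq> (underS r ` Field r)"
  using not_chain_underS_if_two_plus_two two_plus_two_if_not_chain_underS
  by (metis interval_order_def)

lemma (in canonical_representation) interval_order: "interval_order r"
  by (simp add: interval_order_iff_chain_underS finite_poset chain_subset_underS)

lemma interval_order_imp_finite_Field: "interval_order r \<Longrightarrow> finite (Field r)"
  by (simp add: interval_order_def finite_poset_def)

lemma interval_order_imp_chain_underS: "interval_order r \<Longrightarrow> chain\<^sub>\<subseteq> (underS r ` Field r)"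
  by (simp add: interval_order_iff_chain_underS)

lemma left_end_image:
  assumes "interval_order r"
  shows "left_end r ` Field r = {..<mag r}"
proof -
  have "bij_betw (\<lambda>D. card {B \<in> underS r ` Field r. B \<subset> D}) (underS r ` Field r) {..<mag r}"
    unfolding mag_def using assms
    by (intro bij_betw_card_psubsets)
      (simp_all add: interval_order_imp_finite_Field interval_order_imp_chain_underS)
  from bij_betw_imp_surj_on[OF this] show ?thesis
    by (simp add: image_image left_end_def)
qed

lemma left_end_less_iff:
  assumes "interval_order r" "x \<in> Field r" "y \<in> Field r"
  shows "left_end r x < left_end r y \<longleftrightarrow> underS r x \<subset> underS r y"
  unfolding left_end_def using assms
  by (intro card_psubsets_less_iff)
    (simp_all add: interval_order_imp_finite_Field interval_order_imp_chain_underS)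

lemma mem_underS_iff_right_end_le:
  assumes "interval_order r" "y \<in> Field r"
  shows "x \<in> underS r y \<longleftrightarrow> right_end r x \<le> left_end r y"
proof
  let ?\<D> = "underS r ` Field r"
  have fin: "finite ?\<D>" and chain: "chain\<^sub>\<subseteq> ?\<D>"
    using assms(1)
    by (simp_all add: interval_order_imp_finite_Field interval_order_imp_chain_underS)
  show "right_end r x \<le> left_end r y" if "x \<in> underS r y"
  proof -
    have "{D \<in> ?\<D>. x \<notin> D} \<subseteq> {D \<in> ?\<D>. D \<subset> underS r y}"
      using chain that assms(2) unfolding chain_subset_def by blast
    thus ?thesis
      unfolding right_end_def left_end_def using fin by (intro card_mono) auto
  qed
  show "x \<in> underS r y" if le: "right_end r x \<le> left_end r y"
  proof (rule ccontr)
    assume "x \<notin> underS r y"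
    hence "{D \<in> ?\<D>. D \<subset> underS r y} \<subset> {D \<in> ?\<D>. x \<notin> D}"
      using assms(2) by blast
    hence "left_end r y < right_end r x"
      unfolding right_end_def left_end_def using fin by (intro psubset_card_mono) auto
    thus False
      using le by simp
  qed
qed

lemma left_end_less_right_end:
  assumes "interval_order r" "x \<in> Field r"
  shows "left_end r x < right_end r x"
  using mem_underS_iff_right_end_le[OF assms, of x] by (simp add: underS_notIn)

lemma right_end_le_mag:
  assumes "interval_order r"
  shows "right_end r x \<le> mag r"
  unfolding right_end_def mag_def using interval_order_imp_finite_Field[OF assms]
  by (intro card_mono) auto

lemma ex_right_end_eq:
  assumes "interval_order r" "0 < k" "k \<le> mag r"
  shows "\<exists>x\<in>Field r. right_end r x = k"
proof -
  have "k - 1 \<in> left_end r ` Field r"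
    using assms(2,3) by (auto simp: left_end_image[OF assms(1)])
  then obtain z where z: "z \<in> Field r" "left_end r z = k - 1"
    by force
  show ?thesis
  proof (cases "k = mag r")
    case True
    hence "right_end r z = k"
      using left_end_less_right_end[OF assms(1) z(1)] right_end_le_mag[OF assms(1), of z] z(2)
      by simp
    thus ?thesis
      using z(1) by blast
  next
    case False
    hence "k \<in> left_end r ` Field r"
      using assms(3) by (simp add: left_end_image[OF assms(1)])
    then obtain y where y: "y \<in> Field r" "left_end r y = k"
      by force
    have "underS r z \<subset> underS r y"
      using left_end_less_iff[OF assms(1) z(1) y(1)] z(2) y(2) assms(2) by simp
    then obtain x where x: "x \<in> underS r y" "x \<notin> underS r z"
      by blast
    hence "right_end r x = k"
      using mem_underS_iff_right_end_le[OF assms(1)] y z by fastforce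
    moreover have "x \<in> Field r"
      using x(1) underS_Field by fastforce
    ultimately show ?thesis
      by blast
  qed
qed

lemma right_end_image:
  assumes "interval_order r"
  shows "right_end r ` Field r = {1..mag r}"
proof (intro equalityI subsetI)
  fix k assume "k \<in> right_end r ` Field r"
  then obtain x where "x \<in> Field r" "k = right_end r x"
    by blast
  thus "k \<in> {1..mag r}"
    using left_end_less_right_end[OF assms, of x] right_end_le_mag[OF assms, of x] by simp
next
  fix k assume "k \<in> {1..mag r}"
  thus "k \<in> right_end r ` Field r"
    using ex_right_end_eq[OF assms, of k] by auto
qed

lemma canonical_representation_left_end_right_end:
  assumes "interval_order r"
  shows "canonical_representation r (mag r) (left_end r) (right_end r)"
proof
  fix x y assume "x \<in> Field r" "y \<in> Field r"
  hence "(x, y) \<in> r \<longleftrightarrow> x = y \<or> x \<in> underS r y"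
    using assms
    by (auto simp: underS_def interval_order_def finite_poset_def partial_order_on_def
        preorder_on_def refl_on_def)
  thus "(x, y) \<in> r \<longleftrightarrow> x = y \<or> right_end r x \<le> left_end r y"
    by (simp only: mem_underS_iff_right_end_le[OF assms \<open>y \<in> Field r\<close>])
qed (fact assms interval_order_imp_finite_Field[OF assms] left_end_less_right_end[OF assms]
    left_end_image[OF assms] right_end_image[OF assms])+

section \<open>Fishburn matrices\<close>

definition fishburn_matrices :: "nat \<Rightarrow> (nat \<times> nat) set set" where
  "fishburn_matrices m =
     {M. (\<forall>(i, j)\<in>M. i < j) \<and> fst ` M = {..<m} \<and> snd ` M = {1..m}}"

definition fishburn_matrix :: "'a rel \<Rightarrow> (nat \<times> nat) set" where
  "fishburn_matrix r = (\<lambda>x. (left_end r x, right_end r x)) ` Field r"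

definition cell_order :: "(nat \<times> nat) set \<Rightarrow> nat rel" where
  "cell_order M =
     {(x, y). prod_decode x \<in> M \<and> prod_decode y \<in> M \<and>
              (x = y \<or> snd (prod_decode x) \<le> fst (prod_decode y))}"

lemma fishburn_matrices_subset: "fishburn_matrices m \<subseteq> Pow ({..<m} \<times> {1..m})"
proof
  fix M assume "M \<in> fishburn_matrices m"
  thus "M \<in> Pow ({..<m} \<times> {1..m})"
    using subset_fst_snd[of M] by (simp add: fishburn_matrices_def)
qed

lemma finite_fishburn_matrices: "finite (fishburn_matrices m)"
  by (rule finite_subset[OF fishburn_matrices_subset]) simp

lemma Field_cell_order: "Field (cell_order M) = prod_encode ` M"
  unfolding cell_order_def Field_def by (force intro: rev_image_eqI)

lemma canonical_representation_cell_order: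
  assumes "M \<in> fishburn_matrices m"
  shows "canonical_representation (cell_order M) m (fst \<circ> prod_decode) (snd \<circ> prod_decode)"
proof
  have "finite M"
    using assms fishburn_matrices_subset[of m]
    by (intro finite_subset[of M "{..<m} \<times> {1..m}"]) auto
  thus "finite (Field (cell_order M))"
    by (simp add: Field_cell_order)
  show "(fst \<circ> prod_decode) ` Field (cell_order M) = {..<m}"
    "(snd \<circ> prod_decode) ` Field (cell_order M) = {1..m}"
    using assms by (simp_all add: Field_cell_order image_image fishburn_matrices_def)
next
  fix x assume "x \<in> Field (cell_order M)"
  thus "(fst \<circ> prod_decode) x < (snd \<circ> prod_decode) x"
    using assms by (auto simp: Field_cell_order fishburn_matrices_def split_beta)
next
  fix x y assume "x \<in> Field (cell_order M)" "y \<in> Field (cell_order M)"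
  thus "(x, y) \<in> cell_order M \<longleftrightarrow> x = y \<or> (snd \<circ> prod_decode) x \<le> (fst \<circ> prod_decode) y"
    unfolding Field_cell_order by (auto simp: cell_order_def)
qed

lemma primitive_cell_order:
  assumes "M \<in> fishburn_matrices m"
  shows "primitive (cell_order M)"
proof -
  interpret canonical_representation "cell_order M" m "fst \<circ> prod_decode" "snd \<circ> prod_decode"
    by (rule canonical_representation_cell_order[OF assms])
  show ?thesis
    by (simp add: primitive_iff inj_prod_decode)
qed

context canonical_representation
begin

lemma fishburn_matrix_eq: "fishburn_matrix r = (\<lambda>x. (lo x, hi x)) ` Field r"
  by (simp add: fishburn_matrix_def left_end_eq right_end_eq)

lemma fishburn_matrix_mem: "fishburn_matrix r \<in> fishburn_matrices m"
  using image_lo image_hi lo_less_hi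
  by (auto simp: fishburn_matrices_def fishburn_matrix_eq image_image)

lemma poset_isomorphic_cell_order:
  assumes "primitive r"
  shows "poset_isomorphic r (cell_order (fishburn_matrix r))"
  unfolding poset_isomorphic_def
proof (intro exI[of _ "\<lambda>x. prod_encode (lo x, hi x)"] conjI ballI)
  have inj: "inj_on (\<lambda>x. (lo x, hi x)) (Field r)"
    using assms by (simp add: primitive_iff)
  show "bij_betw (\<lambda>x. prod_encode (lo x, hi x)) (Field r) (Field (cell_order (fishburn_matrix r)))"
    using comp_inj_on[OF inj inj_prod_encode]
    by (simp add: bij_betw_def Field_cell_order fishburn_matrix_eq image_image comp_def)
  fix x y assume xy: "x \<in> Field r" "y \<in> Field r"
  have "(prod_encode (lo x, hi x), prod_encode (lo y, hi y)) \<in> cell_order (fishburn_matrix r) \<longleftrightarrow>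
      (lo x, hi x) = (lo y, hi y) \<or> hi x \<le> lo y"
    using xy by (simp add: cell_order_def fishburn_matrix_eq)
  thus "(x, y) \<in> r \<longleftrightarrow>
      (prod_encode (lo x, hi x), prod_encode (lo y, hi y)) \<in> cell_order (fishburn_matrix r)"
    using inj_on_eq_iff[OF inj xy] by (simp add: mem_iff[OF xy])
qed

lemma fishburn_matrix_iso:
  assumes "poset_isomorphic s r"
  shows "fishburn_matrix s = fishburn_matrix r"
proof -
  obtain f where f: "bij_betw f (Field s) (Field r)"
    and iso: "\<And>x y. x \<in> Field s \<Longrightarrow> y \<in> Field s \<Longrightarrow> (x, y) \<in> s \<longleftrightarrow> (f x, f y) \<in> r"
    using assms by (auto simp: poset_isomorphic_def)
  interpret s: canonical_representation s m "lo \<circ> f" "hi \<circ> f"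
    by (rule pullback[OF f iso])
  have "fishburn_matrix s = (\<lambda>x. (lo x, hi x)) ` f ` Field s"
    by (simp add: s.fishburn_matrix_eq image_image)
  thus ?thesis
    using f by (simp add: fishburn_matrix_eq bij_betw_def)
qed

end

lemma fishburn_matrix_cell_order:
  assumes "M \<in> fishburn_matrices m"
  shows "fishburn_matrix (cell_order M) = M"
proof -
  interpret canonical_representation "cell_order M" m "fst \<circ> prod_decode" "snd \<circ> prod_decode"
    by (rule canonical_representation_cell_order[OF assms])
  show ?thesis
    by (simp add: fishburn_matrix_eq Field_cell_order image_image)
qed

lemma inj_on_iso_class_cell_order:
  "inj_on (\<lambda>(n, M). iso_rel `` {cell_order M}) (SIGMA n:UNIV. fishburn_matrices (Suc n))"
proof (rule inj_onI, clarify)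
  fix k M n N
  assume M: "M \<in> fishburn_matrices (Suc k)" and N: "N \<in> fishburn_matrices (Suc n)"
    and classes: "iso_rel `` {cell_order M} = iso_rel `` {cell_order N}"
  interpret N: canonical_representation
      "cell_order N" "Suc n" "fst \<circ> prod_decode" "snd \<circ> prod_decode"
    by (rule canonical_representation_cell_order[OF N])
  have "poset_isomorphic (cell_order M) (cell_order N)"
    using eq_equiv_class[OF classes equiv_iso_rel] N.finite_poset by (simp add: iso_rel_def)
  from N.fishburn_matrix_iso[OF this] have "M = N"
    by (simp add: fishburn_matrix_cell_order[OF M] fishburn_matrix_cell_order[OF N])
  moreover from this have "{..<Suc k} = {..<Suc n}"
    using M N by (auto simp: fishburn_matrices_def)
  ultimately show "k = n \<and> M = N"
    by simp
qed

lemma iso_class_cell_order_mem: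
  assumes "M \<in> fishburn_matrices (Suc n)"
  shows "iso_rel `` {cell_order M} \<in> primitive_interval_orders"
proof -
  interpret canonical_representation "cell_order M" "Suc n" "fst \<circ> prod_decode" "snd \<circ> prod_decode"
    by (rule canonical_representation_cell_order[OF assms])
  have "Field (cell_order M) \<noteq> {}"
    using image_lo by auto
  thus ?thesis
    using interval_order primitive_cell_order[OF assms]
    by (auto simp: primitive_interval_orders_def intro: quotientI)
qed

lemma primitive_interval_order_cases:
  assumes "P \<in> primitive_interval_orders"
  obtains n M where "M \<in> fishburn_matrices (Suc n)" "P = iso_rel `` {cell_order M}"
proof -
  obtain r where r: "Field r \<noteq> {}" "interval_order r" "primitive r" and P: "P = iso_rel `` {r}"
    using assms by (auto simp: primitive_interval_orders_def elim!: quotientE)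
  interpret canonical_representation r "mag r" "left_end r" "right_end r"
    by (rule canonical_representation_left_end_right_end[OF r(2)])
  let ?M = "fishburn_matrix r"
  interpret cells: canonical_representation
      "cell_order ?M" "mag r" "fst \<circ> prod_decode" "snd \<circ> prod_decode"
    by (rule canonical_representation_cell_order[OF fishburn_matrix_mem])
  have "(r, cell_order ?M) \<in> iso_rel"
    using finite_poset cells.finite_poset poset_isomorphic_cell_order[OF r(3)]
    by (simp add: iso_rel_def)
  hence "P = iso_rel `` {cell_order ?M}"
    using equiv_class_eq[OF equiv_iso_rel] P by blast
  moreover obtain n where "mag r = Suc n"
    using r(1) image_lo by (cases "mag r") auto
  ultimately show thesis
    using that fishburn_matrix_mem by simp
qed

lemma bij_betw_primitive_interval_orders:
  "bij_betw (\<lambda>(n, M). iso_rel `` {cell_order M})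
     (SIGMA n:UNIV. fishburn_matrices (Suc n)) primitive_interval_orders"
proof (rule bij_betw_imageI[OF inj_on_iso_class_cell_order], intro equalityI subsetI)
  fix P assume "P \<in> primitive_interval_orders"
  then obtain n M where "M \<in> fishburn_matrices (Suc n)" "P = iso_rel `` {cell_order M}"
    by (rule primitive_interval_order_cases)
  thus "P \<in> (\<lambda>(n, M). iso_rel `` {cell_order M}) ` (SIGMA n:UNIV. fishburn_matrices (Suc n))"
    by force
qed (auto intro: iso_class_cell_order_mem)

definition cell_weight :: "nat \<Rightarrow> nat \<times> nat \<Rightarrow> series" where
  "cell_weight m p =
     (if fst p = 0 then if snd p = m then var_x else var_y
      else if snd p = m then var_v else var_w)"

lemma (in canonical_representation) weight_eq:
  "weight r = var_t ^ m * (\<Prod>x\<in>Field r. cell_weight m (lo x, hi x))"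
proof -
  let ?F = "Field r" and ?min = "{x. lo x = 0}" and ?max = "{x. hi x = m}"
  have "num_iso r = card (?F \<inter> ?min \<inter> ?max)" "num_min r = card (?F \<inter> ?min \<inter> - ?max)"
    "num_max r = card (?F \<inter> - ?min \<inter> ?max)" "num_int r = card (?F \<inter> - ?min \<inter> - ?max)"
    unfolding num_iso_def num_min_def num_max_def num_int_def isolated_iff_minimal_maximal
    using minimal_iff maximal_iff by (auto intro!: arg_cong[where f = card])
  moreover have "(\<Prod>x\<in>?F. cell_weight m (lo x, hi x)) =
    var_x ^ card (?F \<inter> ?min \<inter> ?max) * var_y ^ card (?F \<inter> ?min \<inter> - ?max) *
    (var_v ^ card (?F \<inter> - ?min \<inter> ?max) * var_w ^ card (?F \<inter> - ?min \<inter> - ?max))"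
    using finite_Field by (simp add: cell_weight_def prod.If_cases)
  ultimately show ?thesis
    by (simp add: weight_def mag_eq mult_ac)
qed

lemma class_weight_cell_order:
  assumes "M \<in> fishburn_matrices m"
  shows "class_weight (iso_rel `` {cell_order M}) = var_t ^ m * (\<Prod>p\<in>M. cell_weight m p)"
proof -
  interpret canonical_representation "cell_order M" m "fst \<circ> prod_decode" "snd \<circ> prod_decode"
    by (rule canonical_representation_cell_order[OF assms])
  show ?thesis
    by (simp add: class_weight_eq[OF finite_poset] weight_eq Field_cell_order
        prod.reindex[OF inj_prod_encode])
qed

section \<open>Row-by-row enumeration of Fishburn matrices\<close>

lemma sum_prod_nonempty_subsets:
  fixes w :: "'b \<Rightarrow> 'a::comm_ring_1"
  assumes "finite C"
  shows "(\<Sum>B\<in>Pow C - {{}}. \<Prod>c\<in>B. w c) = (\<Prod>c\<in>C. 1 + w c) - 1"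
proof -
  have "(\<Prod>c\<in>C. 1 + w c) = (\<Sum>B\<in>Pow C. \<Prod>c\<in>B. w c)"
    using prod_add[OF assms, of w "\<lambda>_. 1"] by (simp add: add.commute)
  thus ?thesis
    using assms by (simp add: sum_diff1)
qed

definition partial_fishburn_matrices :: "nat \<Rightarrow> nat set \<Rightarrow> (nat \<times> nat) set set" where
  "partial_fishburn_matrices a C =
     {M. M \<subseteq> (SIGMA i:{..<a}. {i<..<a} \<union> C) \<and> fst ` M = {..<a} \<and> {1..<a} \<subseteq> snd ` M}"

lemma finite_partial_fishburn_matrices:
  "finite C \<Longrightarrow> finite (partial_fishburn_matrices a C)"
  by (rule finite_subset[of _ "Pow (SIGMA i:{..<a}. {i<..<a} \<union> C)"])
    (auto simp: partial_fishburn_matrices_def)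

lemma partial_fishburn_matrices_mono:
  "C \<subseteq> C' \<Longrightarrow> partial_fishburn_matrices a C \<subseteq> partial_fishburn_matrices a C'"
  by (fastforce simp: partial_fishburn_matrices_def)

lemma fishburn_matrices_Suc_eq_partial:
  "fishburn_matrices (Suc n) = partial_fishburn_matrices (Suc n) {Suc n}"
proof (intro equalityI subsetI)
  fix M assume "M \<in> fishburn_matrices (Suc n)"
  hence less: "\<forall>(i, j)\<in>M. i < j" and images: "fst ` M = {..<Suc n}" "snd ` M = {1..Suc n}"
    and subset: "M \<subseteq> {..<Suc n} \<times> {1..Suc n}"
    using fishburn_matrices_subset[of "Suc n"] unfolding fishburn_matrices_def by blast+
  have "M \<subseteq> (SIGMA i:{..<Suc n}. {i<..<Suc n} \<union> {Suc n})"
  proof (rule subrelI)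
    fix i j assume "(i, j) \<in> M"
    hence "i < j" "i < Suc n" "j \<le> Suc n"
      using less subset by auto
    thus "(i, j) \<in> (SIGMA i:{..<Suc n}. {i<..<Suc n} \<union> {Suc n})"
      by auto
  qed
  thus "M \<in> partial_fishburn_matrices (Suc n) {Suc n}"
    using images by (auto simp: partial_fishburn_matrices_def)
next
  fix M assume "M \<in> partial_fishburn_matrices (Suc n) {Suc n}"
  hence cells: "M \<subseteq> (SIGMA i:{..<Suc n}. {i<..<Suc n} \<union> {Suc n})"
    and rows: "fst ` M = {..<Suc n}" and cols: "{1..<Suc n} \<subseteq> snd ` M"
    by (simp_all add: partial_fishburn_matrices_def)
  have "n \<in> fst ` M"
    by (simp add: rows)
  hence "Suc n \<in> snd ` M"
    using cells by force
  moreover have "{1..Suc n} = insert (Suc n) {1..<Suc n}"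
    by auto
  ultimately have "{1..Suc n} \<subseteq> snd ` M"
    using cols by simp
  moreover have "snd ` M \<subseteq> {1..Suc n}" "\<forall>(i, j)\<in>M. i < j"
    using cells by auto
  ultimately show "M \<in> fishburn_matrices (Suc n)"
    using rows by (auto simp: fishburn_matrices_def)
qed

lemma sum_partial_fishburn_matrices_1:
  fixes w :: "nat \<times> nat \<Rightarrow> 'a::comm_ring_1"
  assumes "finite C"
  shows "(\<Sum>M\<in>partial_fishburn_matrices 1 C. \<Prod>p\<in>M. w p) = (\<Prod>j\<in>C. 1 + w (0, j)) - 1"
proof -
  have cells: "(SIGMA i:{..<1}. {i<..<1} \<union> C) = Pair (0::nat) ` C"
    by auto
  have "fst ` M = {0} \<longleftrightarrow> M \<noteq> {}" if "M \<subseteq> Pair 0 ` C" for M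
  proof -
    have "fst ` M \<subseteq> {0}"
      using that by auto
    thus ?thesis
      by (auto simp: subset_singleton_iff)
  qed
  hence "partial_fishburn_matrices 1 C = Pow (Pair 0 ` C) - {{}}"
    unfolding partial_fishburn_matrices_def cells by (auto simp: lessThan_Suc)
  thus ?thesis
    using assms by (simp add: sum_prod_nonempty_subsets prod.reindex inj_on_def)
qed

lemma partial_fishburn_matrices_diff:
  assumes "C \<subseteq> {a<..}"
  shows "partial_fishburn_matrices a (insert a C) - partial_fishburn_matrices a C =
    {M \<in> partial_fishburn_matrices a (insert a C). a \<in> snd ` M}"
proof -
  have "a \<notin> C"
    using assms by auto
  hence avoid: "M \<subseteq> (SIGMA i:{..<a}. {i<..<a} \<union> C) \<longleftrightarrow>
      M \<subseteq> (SIGMA i:{..<a}. {i<..<a} \<union> insert a C) \<and> a \<notin> snd ` M" for M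
    by force
  show ?thesis
    unfolding partial_fishburn_matrices_def avoid by blast
qed

lemma add_row_partial_fishburn_matrix:
  assumes "C \<subseteq> {a<..}" "B \<in> Pow C - {{}}"
    and "N \<in> partial_fishburn_matrices a (insert a C) - partial_fishburn_matrices a C"
  shows "Pair a ` B \<union> N \<in> partial_fishburn_matrices (Suc a) C"
proof -
  have cells: "N \<subseteq> (SIGMA i:{..<a}. {i<..<a} \<union> insert a C)"
    and rows: "fst ` N = {..<a}" and cols: "{1..<a} \<subseteq> snd ` N" and last: "a \<in> snd ` N"
    using assms(3) unfolding partial_fishburn_matrices_diff[OF assms(1)]
    by (simp_all add: partial_fishburn_matrices_def)
  have "Pair a ` B \<union> N \<subseteq> (SIGMA i:{..<Suc a}. {i<..<Suc a} \<union> C)"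
    using cells assms(2) by auto
  moreover have "fst ` Pair a ` B = {a}"
    using assms(2) by (auto simp: image_image)
  hence "fst ` (Pair a ` B \<union> N) = {..<Suc a}"
    by (simp add: image_Un rows lessThan_Suc)
  moreover have "{1..<Suc a} \<subseteq> insert a {1..<a}"
    by auto
  hence "{1..<Suc a} \<subseteq> snd ` (Pair a ` B \<union> N)"
    using cols last by (simp add: image_Un) blast
  ultimately show ?thesis
    by (simp add: partial_fishburn_matrices_def)
qed

lemma last_row_partial_fishburn_matrix:
  assumes "M \<in> partial_fishburn_matrices (Suc a) C"
  shows "M `` {a} \<in> Pow C - {{}}"
proof -
  have cells: "M \<subseteq> (SIGMA i:{..<Suc a}. {i<..<Suc a} \<union> C)" and rows: "fst ` M = {..<Suc a}"
    using assms by (simp_all add: partial_fishburn_matrices_def)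
  have "a \<in> fst ` M"
    by (simp add: rows)
  thus ?thesis
    using cells by force
qed

lemma remove_row_partial_fishburn_matrix:
  assumes "1 \<le> a" "C \<subseteq> {a<..}" "M \<in> partial_fishburn_matrices (Suc a) C"
  shows "M \<inter> {..<a} \<times> UNIV \<in>
    partial_fishburn_matrices a (insert a C) - partial_fishburn_matrices a C"
proof -
  have cells: "M \<subseteq> (SIGMA i:{..<Suc a}. {i<..<Suc a} \<union> C)"
    and rows: "fst ` M = {..<Suc a}" and cols: "{1..<Suc a} \<subseteq> snd ` M"
    using assms(3) by (simp_all add: partial_fishburn_matrices_def)
  let ?N = "M \<inter> {..<a} \<times> UNIV"
  have "?N \<subseteq> (SIGMA i:{..<a}. {i<..<a} \<union> insert a C)"
    using cells by auto
  moreover have "fst ` ?N = {..<a}"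
  proof -
    have "fst ` ?N = fst ` M \<inter> {..<a}"
      by force
    thus ?thesis
      by (auto simp: rows)
  qed
  moreover have "{1..a} \<subseteq> snd ` ?N"
  proof
    fix j assume j: "j \<in> {1..a}"
    hence "j \<in> snd ` M"
      using cols by auto
    then obtain i where "(i, j) \<in> M"
      by auto
    moreover have "j \<notin> C"
      using assms(2) j by auto
    ultimately have "(i, j) \<in> M" "i < a"
      using cells j by auto
    thus "j \<in> snd ` ?N"
      by force
  qed
  moreover have "{1..<a} \<subseteq> {1..a}" "a \<in> {1..a}"
    using assms(1) by auto
  ultimately show "?N \<in> partial_fishburn_matrices a (insert a C) - partial_fishburn_matrices a C"
    unfolding partial_fishburn_matrices_diff[OF assms(2)]
    unfolding partial_fishburn_matrices_def by blast
qed

lemma bij_betw_partial_fishburn_matrices_Suc: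
  assumes "1 \<le> a" "C \<subseteq> {a<..}"
  shows "bij_betw (\<lambda>(B, N). Pair a ` B \<union> N)
    ((Pow C - {{}}) \<times> (partial_fishburn_matrices a (insert a C) - partial_fishburn_matrices a C))
    (partial_fishburn_matrices (Suc a) C)" (is "bij_betw ?add ?pairs ?matrices")
proof (rule bij_betw_byWitness[where f' = "\<lambda>M. (M `` {a}, M \<inter> {..<a} \<times> UNIV)"])
  show "?add ` ?pairs \<subseteq> ?matrices"
    using add_row_partial_fishburn_matrix[OF assms(2)] by auto
  show "(\<lambda>M. (M `` {a}, M \<inter> {..<a} \<times> UNIV)) ` ?matrices \<subseteq> ?pairs"
    using last_row_partial_fishburn_matrix remove_row_partial_fishburn_matrix[OF assms] by blast
  show "\<forall>q\<in>?pairs. (?add q `` {a}, ?add q \<inter> {..<a} \<times> UNIV) = q"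
    by (auto simp: partial_fishburn_matrices_def)
  show "\<forall>M\<in>?matrices. ?add (M `` {a}, M \<inter> {..<a} \<times> UNIV) = M"
  proof
    fix M assume "M \<in> ?matrices"
    hence "M \<subseteq> insert a {..<a} \<times> UNIV"
      by (auto simp: partial_fishburn_matrices_def)
    thus "?add (M `` {a}, M \<inter> {..<a} \<times> UNIV) = M"
      by (auto simp: image_iff)
  qed
qed

lemma sum_partial_fishburn_matrices_Suc:
  fixes w :: "nat \<times> nat \<Rightarrow> 'a::comm_ring_1"
  assumes "1 \<le> a" "finite C" "C \<subseteq> {a<..}"
  shows "(\<Sum>M\<in>partial_fishburn_matrices (Suc a) C. \<Prod>p\<in>M. w p) =
    ((\<Prod>j\<in>C. 1 + w (a, j)) - 1) *
      ((\<Sum>M\<in>partial_fishburn_matrices a (insert a C). \<Prod>p\<in>M. w p) -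
       (\<Sum>M\<in>partial_fishburn_matrices a C. \<Prod>p\<in>M. w p))"
proof -
  let ?old = "partial_fishburn_matrices a (insert a C) - partial_fishburn_matrices a C"
  have split: "(\<Prod>p\<in>Pair a ` B \<union> N. w p) = (\<Prod>j\<in>B. w (a, j)) * (\<Prod>p\<in>N. w p)"
    if "B \<subseteq> C" "N \<in> partial_fishburn_matrices a (insert a C)" for B N
  proof -
    have "N \<subseteq> (SIGMA i:{..<a}. {i<..<a} \<union> insert a C)"
      using that(2) by (simp add: partial_fishburn_matrices_def)
    moreover from this have "finite N"
      by (rule finite_subset) (simp add: assms(2))
    moreover have "finite B"
      using that(1) assms(2) by (rule finite_subset)
    ultimately show ?thesis
      by (subst prod.union_disjoint) (auto simp: prod.reindex inj_on_def)
  qed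
  have "(\<Sum>M\<in>partial_fishburn_matrices (Suc a) C. \<Prod>p\<in>M. w p) =
      (\<Sum>(B, N)\<in>(Pow C - {{}}) \<times> ?old. \<Prod>p\<in>Pair a ` B \<union> N. w p)"
    using sum.reindex_bij_betw[OF bij_betw_partial_fishburn_matrices_Suc[OF assms(1,3)], symmetric]
    by (simp add: case_prod_unfold)
  also have "\<dots> = (\<Sum>B\<in>Pow C - {{}}. \<Sum>N\<in>?old. (\<Prod>j\<in>B. w (a, j)) * (\<Prod>p\<in>N. w p))"
    unfolding sum.cartesian_product by (rule sum.cong) (auto simp: split)
  also have "\<dots> = (\<Sum>B\<in>Pow C - {{}}. \<Prod>j\<in>B. w (a, j)) * (\<Sum>N\<in>?old. \<Prod>p\<in>N. w p)"
    by (rule sum_product[symmetric])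
  finally show ?thesis
    using assms(2) partial_fishburn_matrices_mono[of C "insert a C" a]
    unfolding sum_prod_nonempty_subsets[OF assms(2)]
    by (simp add: sum_diff finite_partial_fishburn_matrices subset_insertI)
qed

lemma prod_cell_weight_row:
  assumes "finite C" "C \<subseteq> {..<m}"
  shows "(\<Prod>j\<in>insert m C. 1 + cell_weight m (i, j)) - 1 =
    (if i = 0 then V (card C) var_x var_y else V (card C) var_v var_w)"
proof -
  have "(\<Prod>j\<in>C. 1 + cell_weight m (i, j)) = (1 + (if i = 0 then var_y else var_w)) ^ card C"
    using assms(2) by (subst prod_constant[symmetric], intro prod.cong) (auto simp: cell_weight_def)
  moreover have "m \<notin> C"
    using assms(2) by auto
  ultimately show ?thesis
    using assms(1) by (simp add: cell_weight_def V_def add.commute)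
qed

lemma sum_partial_fishburn_matrices_cell_weight:
  assumes "a < m" "C \<subseteq> {a<..<m}"
  shows "(\<Sum>M\<in>partial_fishburn_matrices (Suc a) (insert m C). \<Prod>p\<in>M. cell_weight m p) =
    (weighted_diff (\<lambda>k. V k var_v var_w) ^^ a) (\<lambda>k. V k var_x var_y) (card C)"
    (is "_ = (?\<Delta> ^^ a) ?f (card C)")
  using assms
proof (induction a arbitrary: C)
  case 0
  have "finite C"
    using 0 by (auto intro: finite_subset)
  thus ?case
    using 0 sum_partial_fishburn_matrices_1[of "insert m C" "cell_weight m"]
      prod_cell_weight_row[of C m 0] by fastforce
next
  case (Suc a)
  have fin: "finite C"
    using Suc.prems by (auto intro: finite_subset)
  have row: "(\<Prod>j\<in>insert m C. 1 + cell_weight m (Suc a, j)) - 1 = V (card C) var_v var_w"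
    using prod_cell_weight_row[OF fin, of m "Suc a"] Suc.prems by fastforce
  have below: "insert m C \<subseteq> {Suc a<..}" "C \<subseteq> {a<..<m}" "insert (Suc a) C \<subseteq> {a<..<m}"
    using Suc.prems by auto
  have "Suc a \<notin> C"
    using Suc.prems by auto
  hence "card (insert (Suc a) C) = Suc (card C)"
    using fin by simp
  hence "(\<Sum>M\<in>partial_fishburn_matrices (Suc (Suc a)) (insert m C). \<Prod>p\<in>M. cell_weight m p) =
      V (card C) var_v var_w * ((?\<Delta> ^^ a) ?f (Suc (card C)) - (?\<Delta> ^^ a) ?f (card C))"
    using Suc.prems(1) fin below
    by (subst sum_partial_fishburn_matrices_Suc)
      (simp_all add: row insert_commute[of "Suc a"] Suc.IH)
  also have "\<dots> = ?\<Delta> ((?\<Delta> ^^ a) ?f) (card C)"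
    by (rule weighted_diff_def[symmetric])
  finally show ?case
    by simp
qed

lemma sum_fishburn_matrices_cell_weight:
  "(\<Sum>M\<in>fishburn_matrices (Suc n). \<Prod>p\<in>M. cell_weight (Suc n) p) =
    (weighted_diff (\<lambda>k. V k var_v var_w) ^^ n) (\<lambda>k. V k var_x var_y) 0"
  using sum_partial_fishburn_matrices_cell_weight[of n "Suc n" "{}"]
  by (simp add: fishburn_matrices_Suc_eq_partial)

section \<open>The generating function\<close>

lemma has_sum_class_weight:
  assumes "(\<lambda>n. var_t ^ (n + 1) *
    (weighted_diff (\<lambda>k. V k var_v var_w) ^^ n) (\<lambda>k. V k var_x var_y) 0) sums S"
  shows "(class_weight has_sum S) primitive_interval_orders"
proof -
  let ?class = "\<lambda>(n, M). iso_rel `` {cell_order M}"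
  have "((\<lambda>q. class_weight (?class q)) has_sum S) (SIGMA n:UNIV. fishburn_matrices (Suc n))"
  proof (rule has_sum_Sigma_fps)
    show "fps_X ^ n dvd class_weight (?class (n, M))" if "M \<in> fishburn_matrices (Suc n)" for n M
      using that by (simp add: class_weight_cell_order flip: var_t_def)
    have "(\<Sum>M\<in>fishburn_matrices (Suc n). class_weight (?class (n, M))) =
        var_t ^ (n + 1) * (\<Sum>M\<in>fishburn_matrices (Suc n). \<Prod>p\<in>M. cell_weight (Suc n) p)" for n
      by (simp add: class_weight_cell_order sum_distrib_left)
    thus "(\<lambda>n. \<Sum>M\<in>fishburn_matrices (Suc n). class_weight (?class (n, M))) sums S"
      using assms by (simp only: sum_fishburn_matrices_cell_weight)
  qed (rule finite_fishburn_matrices)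
  thus ?thesis
    by (simp only: has_sum_reindex_bij_betw[OF bij_betw_primitive_interval_orders])
qed

theorem theorem1:
  shows "class_weight summable_on primitive_interval_orders \<and>
    (\<lambda>n. var_t ^ (n + 1) * (V n var_x var_y / (1 + var_t * V n var_v var_w)) *
          (\<Prod>i<n. V i var_v var_w / (1 + var_t * V i var_v var_w))) sums P_series"
proof -
  let ?a = "\<lambda>n. var_t ^ (n + 1) *
    (weighted_diff (\<lambda>k. V k var_v var_w) ^^ n) (\<lambda>k. V k var_x var_y) 0"
  have "summable ?a"
    by (rule fps_summableI) (simp add: var_t_def)
  hence sums: "?a sums suminf ?a"
    by (rule summable_sums)
  hence has_sum: "(class_weight has_sum suminf ?a) primitive_interval_orders"
    by (rule has_sum_class_weight)
  hence "P_series = suminf ?a"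
    unfolding P_series_def by (rule infsumI)
  thus ?thesis
    using sums_quotients_if_sums_weighted_diff[OF sums] has_sum_imp_summable[OF has_sum] by simp
qed

end
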